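(* Suppose $\{\lambda_n\}_{n\ge1} \subset (0, 1)$ is an interpolating sequence and $h$ is a positive, decreasing, integrable function on $[0, 1]$. If $\{w_n\}_{n\ge1} \subset \mathbb{C} \setminus \{0\}$ is bounded and satisfies $$-(1 - \lambda_n) \log |w_n| \asymp \int_{0}^{1 - \lambda_n} h(t)\, dt,$$ then there is a bounded outer function $\psi$ such that $\psi(\lambda_n)>0$ for all $n$ and $$-(1 - \lambda_n) \log \psi(\lambda_n) \asymp \int_{0}^{1 - \lambda_n} h(t)\, dt.$$
   Context: $A_n\asymp B_n$ means there are positive constants $c_1,c_2$, independent of $n$, such that $c_1A_n\le B_n\le c_2A_n$ for all $n$. $\mathbb{D}$ is the open unit disk in $\mathbb{C}$, $\mathbb{T}$ the unit circle, $m$ normalized Lebesgue measure on $\mathbb{T}$. A sequence $\Lambda=\{\lambda_n\}_{n\ge1}$ of distinct points of $\mathbb{D}$ is interpolating if $\delta(\Lambda) := \inf_{n \geq 1} \prod_{k\ge 1, k \ne n} \left| \frac{\lambda_k-\lambda_n}{1-\overline{\lambda}_k \lambda_n}\right| > 0$. An outer function is an analytic function on $\mathbb{D}$ of the form $\phi(z)=\gamma\exp\big(\int_{\mathbb{T}} \frac{\xi + z}{\xi - z} W(\xi)\, dm(\xi)\big)$, where $|\gamma|=1$ and $W$ is an extended real-valued integrable function on $\mathbb{T}$; a bounded outer function is one that is bounded on $\mathbb{D}$. "Decreasing" means nonincreasing, and $h$ may be unbounded near $0$ (it is finite on $(0,1]$ and the value $h(0)=+\infty$ is allowed). *)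

theory Defs
  imports "HOL-Analysis.Analysis"
begin

text \<open>Sequences are indexed by the natural numbers starting at 0.\<close>

definition comparable :: "(nat \<Rightarrow> real) \<Rightarrow> (nat \<Rightarrow> real) \<Rightarrow> bool" where
  "comparable A B \<longleftrightarrow>
     (\<exists>c1 > 0. \<exists>c2 > 0. \<forall>n. c1 * A n \<le> B n \<and> B n \<le> c2 * A n)"

text \<open>
  The infinite product is the limit of its partial products, and not \<^const>\<open>prodinf\<close>, which is
  unspecified for products diverging to 0. For points of the unit disk all factors lie in [0, 1],
  so the limit exists.
\<close>

definition separation_constant :: "(nat \<Rightarrow> complex) \<Rightarrow> real" where
  "separation_constant z =
     (INF n. lim (\<lambda>N. \<Prod>k\<in>{..<N} - {n}. cmod ((z k - z n) / (1 - cnj (z k) * z n))))"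

definition interpolating :: "(nat \<Rightarrow> complex) \<Rightarrow> bool" where
  "interpolating z \<longleftrightarrow>
     inj z \<and> range z \<subseteq> ball 0 1 \<and> separation_constant z > 0"

definition circle_measure :: "complex measure" where
  "circle_measure =
     distr (uniform_measure lborel {0..2 * pi}) (restrict_space borel (sphere 0 1)) cis"

text \<open>
  The weight \<open>W\<close> may take infinite values, but only on a null set, so that passing to
  \<^const>\<open>real_of_ereal\<close> does not change the integral. Borel measurable weights suffice since a
  Lebesgue measurable function agrees with a Borel measurable one almost everywhere.
\<close>

definition outer_function :: "(complex \<Rightarrow> complex) \<Rightarrow> bool" where
  "outer_function \<phi> \<longleftrightarrow>
     \<phi> analytic_on ball 0 1 \<and>
     (\<exists>\<gamma> W. cmod \<gamma> = 1 \<and>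
        W \<in> borel_measurable circle_measure \<and>
        (\<integral>\<^sup>+\<xi>. e2ennreal \<bar>W \<xi>\<bar> \<partial>circle_measure) < \<infinity> \<and>
        (\<forall>z\<in>ball 0 1. \<phi> z =
           \<gamma> * exp (\<integral>\<xi>. (\<xi> + z) / (\<xi> - z) * complex_of_real (real_of_ereal (W \<xi>))
                 \<partial>circle_measure)))"

definition bounded_outer_function :: "(complex \<Rightarrow> complex) \<Rightarrow> bool" where
  "bounded_outer_function \<phi> \<longleftrightarrow> outer_function \<phi> \<and> bounded (\<phi> ` ball 0 1)"

text \<open>
  Values in \<^typ>\<open>ennreal\<close> allow \<open>h 0 = \<infinity>\<close>. Measurability on [0, 1] follows from monotonicity, so
  integrability amounts to a finite integral.
\<close>

definition admissible_weight :: "(real \<Rightarrow> ennreal) \<Rightarrow> bool" where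
  "admissible_weight h \<longleftrightarrow>
     (\<forall>t\<in>{0..1}. 0 < h t) \<and>
     (\<forall>t\<in>{0<..1}. h t < \<infinity>) \<and>
     antimono_on {0..1} h \<and>
     (\<integral>\<^sup>+t\<in>{0..1}. h t \<partial>lborel) < \<infinity>"

definition weight_integral :: "(real \<Rightarrow> ennreal) \<Rightarrow> real \<Rightarrow> real" where
  "weight_integral h x = enn2real (\<integral>\<^sup>+t\<in>{0..x}. h t \<partial>lborel)"

end

theory Submission
  imports Defs
begin

text \<open>
  Take the outer function \<open>\<psi>\<close> with boundary weight \<open>W(e^{it}) = -h(\<bar>t\<bar>)\<close> for \<open>0 < \<bar>t\<bar> \<le> 1\<close> and
  \<open>W = 0\<close> elsewhere. It is bounded since \<open>W \<le> 0\<close>, and real and positive on \<open>(0, 1)\<close> since \<open>W\<close> is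
  symmetric; there \<open>- log \<psi>(r)\<close> is the Poisson integral of \<open>h(\<bar>t\<bar>)\<close>. With \<open>a = 1 - r\<close>, the
  Poisson kernel is comparable to \<open>1/a\<close> for \<open>\<bar>t\<bar> \<le> a\<close>, so this range contributes a multiple of
  \<open>1/a\<close> times the integral of \<open>h\<close> over \<open>[0, a]\<close>. For \<open>\<bar>t\<bar> > a\<close> the kernel is at most \<open>8a/t\<^sup>2\<close>
  and \<open>h(t) \<le> h(a)\<close>, so the tail contributes at most a multiple of \<open>h(a)\<close>, and \<open>a h(a)\<close> is
  dominated by the integral of \<open>h\<close> over \<open>[0, a]\<close> because \<open>h\<close> decreases.
\<close>

section \<open>Integration over the circle\<close>

lemma space_circle_measure [simp]: "space circle_measure = sphere 0 1"
  by (simp add: circle_measure_def space_restrict_space)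

lemma sets_circle_measure [measurable_cong]:
  "sets circle_measure = sets (restrict_space borel (sphere 0 1))"
  by (simp add: circle_measure_def)

lemma borel_measurable_circle_measure:
  "f \<in> borel_measurable borel \<Longrightarrow> f \<in> borel_measurable circle_measure"
  by (simp add: measurable_cong_sets[OF sets_circle_measure refl] measurable_restrict_space1)

lemma uniform_measure_circle_density:
  "uniform_measure lborel {0..2 * pi} =
    density lborel (\<lambda>t. ennreal (indicator {0..2 * pi} t / (2 * pi)))"
  unfolding uniform_measure_def
  by (intro arg_cong2[where f=density] ext refl)
    (auto simp: indicator_def divide_ennreal simp flip: ennreal_1)

lemma cis_measurable_circle:
  "cis \<in> density lborel f \<rightarrow>\<^sub>M restrict_space borel (sphere 0 1)"
proof -
  have "cis \<in> borel_measurable borel"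
    by (intro borel_measurable_continuous_onI continuous_intros)
  then show ?thesis
    by (intro measurable_restrict_space2) auto
qed

lemma
  fixes F :: "complex \<Rightarrow> 'b::{banach, second_countable_topology}"
  assumes F: "F \<in> borel_measurable circle_measure"
  shows integrable_circle_measure_iff:
      "integrable circle_measure F \<longleftrightarrow> set_integrable lborel {0..2 * pi} (\<lambda>t. F (cis t))"
    and integral_circle_measure:
      "integral\<^sup>L circle_measure F = (1 / (2 * pi)) *\<^sub>R (LINT t:{0..2 * pi}|lborel. F (cis t))"
proof -
  have F': "F \<in> borel_measurable (restrict_space borel (sphere 0 1))"
    using F by (simp add: measurable_cong_sets[OF sets_circle_measure refl])
  have m: "(\<lambda>t. F (cis t)) \<in> borel_measurable lborel"
    using measurable_compose[OF cis_measurable_circle F'] by simp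
  have eq: "(indicator {0..2 * pi} t / (2 * pi)) *\<^sub>R F (cis t)
      = (1 / (2 * pi)) *\<^sub>R (indicator {0..2 * pi} t *\<^sub>R F (cis t))" for t :: real
    by simp
  have unscale: "integrable lborel f" if "integrable lborel (\<lambda>t. (1 / (2 * pi)) *\<^sub>R f t)"
    for f :: "real \<Rightarrow> 'b"
    using integrable_scaleR_right[OF that, of "2 * pi"] by simp
  show "integrable circle_measure F \<longleftrightarrow> set_integrable lborel {0..2 * pi} (\<lambda>t. F (cis t))"
    unfolding circle_measure_def uniform_measure_circle_density
      integrable_distr_eq[OF cis_measurable_circle F'] set_integrable_def
    by (subst integrable_density) (use m in \<open>auto simp del: scaleR_scaleR simp: eq dest: unscale\<close>)
  show "integral\<^sup>L circle_measure F = (1 / (2 * pi)) *\<^sub>R (LINT t:{0..2 * pi}|lborel. F (cis t))"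
    unfolding circle_measure_def uniform_measure_circle_density
      integral_distr[OF cis_measurable_circle F'] set_lebesgue_integral_def
    by (subst integral_density) (use m in \<open>auto simp del: scaleR_scaleR simp: eq\<close>)
qed

text \<open>Cutting the circle at angle pi and reflecting the lower half by t -> 2 pi - t puts
  conjugate points side by side. For an integrand with conjugate symmetry the sum under the integral
  is then twice its real part.\<close>

lemma
  fixes F :: "complex \<Rightarrow> 'b::{banach, second_countable_topology}"
  assumes F: "F \<in> borel_measurable circle_measure"
    and upper: "set_integrable lborel {0..pi} (\<lambda>t. F (cis t))"
    and lower: "set_integrable lborel {0..pi} (\<lambda>t. F (cis (- t)))"
  shows integrable_circle_measure_halves: "integrable circle_measure F"
    and integral_circle_measure_halves:
      "integral\<^sup>L circle_measure F =
        (1 / (2 * pi)) *\<^sub>R (LINT t:{0..pi}|lborel. F (cis t) + F (cis (- t)))"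
proof -
  have cis_reflect: "cis (2 * pi - t) = cis (- t)" for t
    by (simp add: complex_eq_iff cos_diff sin_diff)
  \<comment> \<open>The lower half extended by zero to the whole line, so that the affine
    substitution rules for \<open>lborel\<close> apply to it.\<close>
  define G where "G t = indicator {pi..2 * pi} t *\<^sub>R F (cis t)" for t
  have G: "G (2 * pi + (-1) * t) = indicator {0..pi} t *\<^sub>R F (cis (- t))" for t
    using cis_reflect[of t] by (auto simp: G_def indicator_def)
  have int_G: "integrable lborel G"
    using lower lborel_integrable_real_affine_iff[of "-1" G "2 * pi"]
    unfolding G set_integrable_def by simp
  then have upper': "set_integrable lborel {pi..2 * pi} (\<lambda>t. F (cis t))"
    unfolding set_integrable_def G_def .
  have eq: "(LINT t:{pi..2 * pi}|lborel. F (cis t)) = (LINT t:{0..pi}|lborel. F (cis (- t)))"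
    using lborel_integral_real_affine[of "-1" G "2 * pi"]
    unfolding G unfolding set_lebesgue_integral_def G_def by simp
  have un: "{0..2 * pi} = {0..pi} \<union> {pi..2 * pi}"
    using pi_ge_zero by auto
  \<comment> \<open>The two intervals overlap only in the null set {pi}, so the integrals still
    add.\<close>
  have ae: "AE x in lborel. \<not> (x \<in> {0..pi} \<and> x \<in> {pi..2 * pi})"
    by (rule AE_I[of _ _ "{pi}"]) auto
  show "integrable circle_measure F"
    unfolding integrable_circle_measure_iff[OF F] un
    by (intro set_integrable_Un upper upper') auto
  show "integral\<^sup>L circle_measure F =
        (1 / (2 * pi)) *\<^sub>R (LINT t:{0..pi}|lborel. F (cis t) + F (cis (- t)))"
    unfolding integral_circle_measure[OF F] un
    by (subst set_integral_Un_AE[OF ae _ _ upper upper'])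
      (simp_all add: eq set_integral_add[OF upper lower])
qed

section \<open>Herglotz integrals\<close>

definition herglotz :: "complex \<Rightarrow> complex \<Rightarrow> complex" where
  "herglotz \<xi> z = (\<xi> + z) / (\<xi> - z)"

lemma borel_measurable_herglotz [measurable]:
  "(\<lambda>\<xi>. herglotz \<xi> z) \<in> borel_measurable circle_measure"
  unfolding herglotz_def by (intro borel_measurable_circle_measure) measurable

lemma norm_diff_sphere_ball_ge: "norm \<xi> = 1 \<Longrightarrow> 1 - norm z \<le> norm (\<xi> - z)"
  for \<xi> z :: complex
  using norm_triangle_ineq2[of \<xi> z] by simp

lemma norm_herglotz_le:
  assumes "norm \<xi> = 1" "norm z < 1"
  shows "norm (herglotz \<xi> z) \<le> 2 / (1 - norm z)"
  unfolding herglotz_def norm_divide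
  using norm_diff_sphere_ball_ge[OF assms(1), of z] norm_triangle_ineq[of \<xi> z] assms
  by (intro frac_le) auto

text \<open>Multiplying by the conjugate of the denominator leaves \<open>1 - |z|^2\<close> as real
  part of the numerator. This is the Poisson kernel; its positivity on the disk is what bounds the
  outer function below.\<close>

lemma Re_herglotz:
  assumes "norm \<xi> = 1"
  shows "Re (herglotz \<xi> z) = (1 - (norm z)\<^sup>2) / (norm (\<xi> - z))\<^sup>2"
proof -
  have 1: "(Re \<xi>)\<^sup>2 + (Im \<xi>)\<^sup>2 = 1"
    using assms cmod_power2[of \<xi>] by simp
  have "(Re \<xi> + Re z) * (Re \<xi> - Re z) + (Im \<xi> + Im z) * (Im \<xi> - Im z)
      = 1 - ((Re z)\<^sup>2 + (Im z)\<^sup>2)"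
    unfolding 1[symmetric] by algebra
  then show ?thesis
    by (simp add: herglotz_def Re_divide cmod_power2 add_divide_distrib[symmetric])
qed

lemma integrable_bounded_mult:
  fixes k :: "complex \<Rightarrow> complex" and v :: "complex \<Rightarrow> real"
  assumes "integrable circle_measure v"
    and "k \<in> borel_measurable circle_measure"
    and "\<And>\<xi>. norm \<xi> = 1 \<Longrightarrow> norm (k \<xi>) \<le> C"
  shows "integrable circle_measure (\<lambda>\<xi>. k \<xi> * of_real (v \<xi>))"
proof (rule Bochner_Integration.integrable_bound)
  show "integrable circle_measure (\<lambda>\<xi>. C * v \<xi>)"
    using assms(1) by simp
  show "(\<lambda>\<xi>. k \<xi> * of_real (v \<xi>)) \<in> borel_measurable circle_measure"
    using assms(1,2) by measurable
  have "norm (k \<xi> * of_real (v \<xi>)) \<le> norm (C * v \<xi>)" if "norm \<xi> = 1" for \<xi>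
  proof -
    have "norm (k \<xi>) * \<bar>v \<xi>\<bar> \<le> \<bar>C\<bar> * \<bar>v \<xi>\<bar>"
      using assms(3)[OF that] by (intro mult_right_mono) auto
    then show ?thesis by (simp add: norm_mult abs_mult)
  qed
  then show "AE \<xi> in circle_measure. norm (k \<xi> * of_real (v \<xi>)) \<le> norm (C * v \<xi>)"
    by (intro AE_I2) simp
qed

lemma integrable_herglotz:
  assumes "integrable circle_measure v" "norm z < 1"
  shows "integrable circle_measure (\<lambda>\<xi>. herglotz \<xi> z * complex_of_real (v \<xi>))"
  using assms norm_herglotz_le by (intro integrable_bounded_mult) auto

text \<open>Differentiation under the integral sign: the difference quotients of the kernel converge
  pointwise and are uniformly bounded near z, so dominated convergence applies with a multiple of
  \<open>|v|\<close> as majorant.\<close>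

lemma holomorphic_herglotz_integral:
  assumes v: "integrable circle_measure v"
  shows "(\<lambda>z. \<integral>\<xi>. herglotz \<xi> z * complex_of_real (v \<xi>) \<partial>circle_measure) holomorphic_on ball 0 1"
proof -
  define f where "f z = (\<integral>\<xi>. herglotz \<xi> z * complex_of_real (v \<xi>) \<partial>circle_measure)" for z
  \<comment> \<open>For y distinct from z this is the difference quotient of
    \<open>herglotz \<xi>\<close> between z and y; at y = z it is the derivative there.\<close>
  define q where "q z y \<xi> = 2 * \<xi> / ((\<xi> - z) * (\<xi> - y))" for z y \<xi> :: complex
  have deriv: "(f has_field_derivative (\<integral>\<xi>. q z z \<xi> * complex_of_real (v \<xi>) \<partial>circle_measure)) (at z)"
    if z: "norm z < 1" for z
  proof -
    have quot: "(f y - f z) / (y - z) = (\<integral>\<xi>. q z y \<xi> * complex_of_real (v \<xi>) \<partial>circle_measure)"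
      if y: "norm y < 1" "y \<noteq> z" for y
    proof -
      have "f y - f z = (\<integral>\<xi>. herglotz \<xi> y * complex_of_real (v \<xi>)
            - herglotz \<xi> z * complex_of_real (v \<xi>) \<partial>circle_measure)"
        unfolding f_def
        by (intro Bochner_Integration.integral_diff[symmetric] integrable_herglotz v y z)
      also have "\<dots> = (\<integral>\<xi>. (y - z) * (q z y \<xi> * complex_of_real (v \<xi>)) \<partial>circle_measure)"
      proof (rule Bochner_Integration.integral_cong[OF refl])
        fix \<xi> assume "\<xi> \<in> space circle_measure"
        then have "\<xi> \<noteq> y" "\<xi> \<noteq> z"
          using y z by auto
        then have "herglotz \<xi> y - herglotz \<xi> z = (y - z) * q z y \<xi>"
          unfolding herglotz_def q_def by (simp add: divide_simps) (simp add: algebra_simps)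
        then show "herglotz \<xi> y * complex_of_real (v \<xi>) - herglotz \<xi> z * complex_of_real (v \<xi>)
            = (y - z) * (q z y \<xi> * complex_of_real (v \<xi>))"
          by (simp only: left_diff_distrib[symmetric] mult.assoc)
      qed
      finally show ?thesis
        using y by simp
    qed
    have q_meas: "q z y \<in> borel_measurable circle_measure" for y
      unfolding q_def by (intro borel_measurable_circle_measure) measurable
    have v_meas: "(\<lambda>\<xi>. complex_of_real (v \<xi>)) \<in> borel_measurable circle_measure"
      using v by measurable
    \<comment> \<open>Half the distance from z to the circle: points within d of z have norm at most
      1 - d, so both factors in the denominator of \<open>q\<close> have norm at least d.\<close>
    define d where "d = (1 - norm z) / 2"
    have d: "0 < d" using z by (simp add: d_def)
    have "((\<lambda>y. (f y - f z) / (y - z)) \<longlongrightarrow>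
        (\<integral>\<xi>. q z z \<xi> * complex_of_real (v \<xi>) \<partial>circle_measure)) (at z)"
      unfolding tendsto_at_iff_sequentially
    proof (intro allI impI)
      fix X :: "nat \<Rightarrow> complex"
      assume X: "\<forall>i. X i \<in> UNIV - {z}" and lim: "X \<longlonglongrightarrow> z"
      from lim d have ev: "\<forall>\<^sub>F i in sequentially. dist (X i) z < d"
        by (rule tendstoD)
      then obtain N where N: "\<And>i. i \<ge> N \<Longrightarrow> dist (X i) z < d"
        by (auto simp: eventually_sequentially)
      have limN: "(\<lambda>i. X (i + N)) \<longlonglongrightarrow> z"
        by (rule LIMSEQ_ignore_initial_segment[OF lim])
      have nX: "norm (X i) \<le> 1 - d" if "i \<ge> N" for i
        using N[OF that] norm_triangle_ineq2[of "X i" z] unfolding d_def dist_norm by argo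
      \<comment> \<open>The majorant is valid only from index N on, hence the shifted sequence;
        \<open>LIMSEQ_offset\<close> removes the shift at the end.\<close>
      have "(\<lambda>i. \<integral>\<xi>. q z (X (i + N)) \<xi> * complex_of_real (v \<xi>) \<partial>circle_measure)
          \<longlonglongrightarrow> (\<integral>\<xi>. q z z \<xi> * complex_of_real (v \<xi>) \<partial>circle_measure)"
      proof (rule integral_dominated_convergence[where w="\<lambda>\<xi>. (2 / (d * d)) * \<bar>v \<xi>\<bar>"])
        show "(\<lambda>\<xi>. q z z \<xi> * complex_of_real (v \<xi>)) \<in> borel_measurable circle_measure"
          "\<And>i. (\<lambda>\<xi>. q z (X (i + N)) \<xi> * complex_of_real (v \<xi>)) \<in> borel_measurable circle_measure"
          by (rule borel_measurable_times[OF q_meas v_meas])+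
        show "integrable circle_measure (\<lambda>\<xi>. (2 / (d * d)) * \<bar>v \<xi>\<bar>)"
          using v by simp
        show "AE \<xi> in circle_measure. (\<lambda>i. q z (X (i + N)) \<xi> * complex_of_real (v \<xi>))
            \<longlonglongrightarrow> q z z \<xi> * complex_of_real (v \<xi>)"
        proof (rule AE_I2)
          fix \<xi> assume "\<xi> \<in> space circle_measure"
          then have "\<xi> \<noteq> z" using z by auto
          then show "(\<lambda>i. q z (X (i + N)) \<xi> * complex_of_real (v \<xi>))
              \<longlonglongrightarrow> q z z \<xi> * complex_of_real (v \<xi>)"
            unfolding q_def by (intro tendsto_intros limN) auto
        qed
        show "AE \<xi> in circle_measure.
            norm (q z (X (i + N)) \<xi> * complex_of_real (v \<xi>)) \<le> (2 / (d * d)) * \<bar>v \<xi>\<bar>" for i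
        proof (rule AE_I2)
          fix \<xi> assume "\<xi> \<in> space circle_measure"
          then have \<xi>: "norm \<xi> = 1" by simp
          have "d \<le> norm (\<xi> - z)" "d \<le> norm (\<xi> - X (i + N))"
            using norm_diff_sphere_ball_ge[OF \<xi>, of z] d
              norm_diff_sphere_ball_ge[OF \<xi>, of "X (i + N)"] nX[of "i + N", OF le_add2]
            unfolding d_def by argo+
          then have "norm (q z (X (i + N)) \<xi>) \<le> 2 / (d * d)"
            unfolding q_def norm_divide norm_mult using \<xi> d
            by (intro frac_le mult_mono) auto
          then show "norm (q z (X (i + N)) \<xi> * complex_of_real (v \<xi>)) \<le> (2 / (d * d)) * \<bar>v \<xi>\<bar>"
            unfolding norm_mult norm_of_real by (intro mult_right_mono) auto
        qed
      qed
      moreover have "(f (X (i + N)) - f z) / (X (i + N) - z)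
          = (\<integral>\<xi>. q z (X (i + N)) \<xi> * complex_of_real (v \<xi>) \<partial>circle_measure)" for i
        using X nX[of "i + N"] d by (intro quot) auto
      ultimately show "((\<lambda>y. (f y - f z) / (y - z)) \<circ> X) \<longlonglongrightarrow>
          (\<integral>\<xi>. q z z \<xi> * complex_of_real (v \<xi>) \<partial>circle_measure)"
        unfolding o_def by - (rule LIMSEQ_offset[where k=N], simp)
    qed
    then show ?thesis
      unfolding has_field_derivative_iff .
  qed
  have "f holomorphic_on ball 0 1"
    unfolding holomorphic_on_open[OF open_ball] by (intro ballI, rule exI, rule deriv) simp
  then show ?thesis
    unfolding f_def .
qed

text \<open>The modulus is the exponential of the integral of \<open>v\<close> against the
  nonnegative Poisson kernel, so \<open>v \<le> 0\<close> gives the bound 1. The witnesses are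
  \<gamma> = 1 and the finite weight \<open>v\<close> itself.\<close>

lemma bounded_outer_function_exp_herglotz:
  assumes v: "integrable circle_measure v" and "\<And>\<xi>. v \<xi> \<le> 0"
  shows "bounded_outer_function
    (\<lambda>z. exp (\<integral>\<xi>. herglotz \<xi> z * complex_of_real (v \<xi>) \<partial>circle_measure))"
  unfolding bounded_outer_function_def outer_function_def
proof (intro conjI exI[of _ 1] exI[of _ "\<lambda>\<xi>. ereal (v \<xi>)"])
  show "(\<lambda>z. exp (\<integral>\<xi>. herglotz \<xi> z * complex_of_real (v \<xi>) \<partial>circle_measure))
      analytic_on ball 0 1"
    unfolding analytic_on_open[OF open_ball]
    by (rule holomorphic_on_compose[unfolded o_def,
          OF holomorphic_herglotz_integral[OF v] holomorphic_on_exp])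
  show "(\<lambda>\<xi>. ereal (v \<xi>)) \<in> borel_measurable circle_measure"
    using v by measurable
  show "(\<integral>\<^sup>+\<xi>. e2ennreal \<bar>ereal (v \<xi>)\<bar> \<partial>circle_measure) < \<infinity>"
    using v by (simp add: integrable_iff_bounded)
  have "norm (exp (\<integral>\<xi>. herglotz \<xi> z * complex_of_real (v \<xi>) \<partial>circle_measure)) \<le> 1"
    if "norm z < 1" for z
  proof -
    have "Re (\<integral>\<xi>. herglotz \<xi> z * complex_of_real (v \<xi>) \<partial>circle_measure)
        = (\<integral>\<xi>. Re (herglotz \<xi> z) * v \<xi> \<partial>circle_measure)"
      using integral_Re[OF integrable_herglotz[OF v that]] by simp
    also have "\<dots> = - (\<integral>\<xi>. - (Re (herglotz \<xi> z) * v \<xi>) \<partial>circle_measure)"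
      by simp
    also have "\<dots> \<le> 0"
    proof (simp only: neg_le_0_iff_le, rule integral_nonneg_AE, rule AE_I2)
      fix \<xi> assume "\<xi> \<in> space circle_measure"
      then have "0 \<le> Re (herglotz \<xi> z)"
        using that by (simp add: Re_herglotz power_le_one)
      then show "0 \<le> - (Re (herglotz \<xi> z) * v \<xi>)"
        using assms(2) by (simp add: mult_nonneg_nonpos)
    qed
    finally show ?thesis by simp
  qed
  then show "bounded ((\<lambda>z. exp (\<integral>\<xi>. herglotz \<xi> z * complex_of_real (v \<xi>) \<partial>circle_measure)) ` ball 0 1)"
    by (auto simp: bounded_iff intro!: exI[of _ 1])
qed (auto simp: herglotz_def)

section \<open>Poisson integrals of symmetric weights at real points\<close>

text \<open>
  A symmetric weight is written as \<open>g (arccos (Re \<xi>))\<close>, because \<open>arccos (Re (cis t)) = \<bar>t\<bar>\<close> for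
  \<open>\<bar>t\<bar> \<le> pi\<close>.
\<close>

definition poisson :: "real \<Rightarrow> real \<Rightarrow> real" where
  "poisson r t = (1 - r\<^sup>2) / ((1 - r)\<^sup>2 + 2 * r * (1 - cos t))"

lemma norm_cis_diff_power2:
  "(norm (cis t - of_real r))\<^sup>2 = (1 - r)\<^sup>2 + 2 * r * (1 - cos t)"
proof -
  have "(norm (cis t - of_real r))\<^sup>2 = ((sin t)\<^sup>2 + (cos t)\<^sup>2) - 2 * r * cos t + r\<^sup>2"
    by (simp add: cmod_power2 power2_diff)
  then show ?thesis
    by (simp add: power2_diff algebra_simps)
qed

lemma Re_herglotz_cis:
  "Re (herglotz (cis t) (of_real r)) = poisson r t"
  by (simp add: Re_herglotz norm_cis_diff_power2 poisson_def)

lemma herglotz_cis_minus: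
  "herglotz (cis (- t)) (of_real r) = cnj (herglotz (cis t) (of_real r))"
  by (simp add: herglotz_def flip: cis_cnj)

lemma borel_measurable_arccos_Re:
  assumes "g \<in> borel_measurable borel"
  shows "(\<lambda>\<xi>. g (arccos (Re \<xi>))) \<in> borel_measurable circle_measure"
proof -
  have "continuous_on (sphere 0 1) (\<lambda>\<xi>. arccos (Re \<xi>))"
  proof (intro continuous_intros ballI)
    fix \<xi> :: complex assume "\<xi> \<in> sphere 0 1"
    then show "-1 \<le> Re \<xi> \<and> Re \<xi> \<le> 1" 
      using abs_Re_le_cmod[of \<xi>] by auto
  qed
  then have "(\<lambda>\<xi>. arccos (Re \<xi>)) \<in> borel_measurable (restrict_space borel (sphere 0 1))"
    by (rule borel_measurable_continuous_on_restrict)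
  from measurable_compose[OF this assms] show ?thesis
    by (simp add: measurable_cong_sets[OF sets_circle_measure refl])
qed

text \<open>At a real point the kernel takes conjugate values at conjugate points of the circle,
  where the weight agrees. The imaginary parts cancel and the real parts double, which turns the
  normalization 1 / (2 pi) into 1 / pi.\<close>

lemma
  assumes g: "g \<in> borel_measurable borel" and int: "set_integrable lborel {0..pi} g"
  shows integrable_arccos_Re: "integrable circle_measure (\<lambda>\<xi>. g (arccos (Re \<xi>)))"
    and herglotz_integral_arccos_Re:
      "\<bar>r\<bar> < 1 \<Longrightarrow>
        (\<integral>\<xi>. herglotz \<xi> (of_real r) * complex_of_real (g (arccos (Re \<xi>))) \<partial>circle_measure) =
        of_real (1 / pi * (LINT t:{0..pi}|lborel. poisson r t * g t))"
proof -
  have eq: "set_integrable lborel {0..pi} (\<lambda>t. g (arccos (cos t)))"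
    using int by (subst set_integrable_cong[OF refl refl, where f'=g]) (auto simp: arccos_cos)
  show v: "integrable circle_measure (\<lambda>\<xi>. g (arccos (Re \<xi>)))"
    by (rule integrable_circle_measure_halves[OF borel_measurable_arccos_Re[OF g]])
      (use eq in simp_all)
  show "(\<integral>\<xi>. herglotz \<xi> (of_real r) * complex_of_real (g (arccos (Re \<xi>))) \<partial>circle_measure) =
        of_real (1 / pi * (LINT t:{0..pi}|lborel. poisson r t * g t))" if r: "\<bar>r\<bar> < 1"
  proof -
    define F where "F \<xi> = herglotz \<xi> (of_real r) * complex_of_real (g (arccos (Re \<xi>)))" for \<xi>
    have F_int: "integrable circle_measure F"
      unfolding F_def using r by (intro integrable_herglotz v) auto
    then have F: "F \<in> borel_measurable circle_measure" by measurable
    have full: "set_integrable lborel {0..2 * pi} (\<lambda>t. F (cis t))"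
      using F_int integrable_circle_measure_iff[OF F] by simp
    then have upper: "set_integrable lborel {0..pi} (\<lambda>t. F (cis t))"
      by (rule set_integrable_subset) auto
    have F_minus: "F (cis (- t)) = cnj (F (cis t))" for t
      by (simp add: F_def herglotz_cis_minus)
    from upper have lower: "set_integrable lborel {0..pi} (\<lambda>t. F (cis (- t)))"
      unfolding F_minus set_integrable_def
      using integrable_cnj[of lborel "\<lambda>t. indicator {0..pi} t *\<^sub>R F (cis t)"] by simp
    have sum: "F (cis t) + F (cis (- t)) = of_real (2 * (poisson r t * g t))"
      if "t \<in> {0..pi}" for t
      using that unfolding F_minus complex_add_cnj
      by (simp add: F_def Re_herglotz_cis arccos_cos)
    have "integral\<^sup>L circle_measure F =
        (1 / (2 * pi)) *\<^sub>R (LINT t:{0..pi}|lborel. F (cis t) + F (cis (- t)))"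
      by (rule integral_circle_measure_halves[OF F upper lower])
    also have "(LINT t:{0..pi}|lborel. F (cis t) + F (cis (- t)))
        = (LINT t:{0..pi}|lborel. complex_of_real (2 * (poisson r t * g t)))"
      by (rule set_lebesgue_integral_cong) (simp, use sum in blast)
    also have "\<dots> = of_real (2 * (LINT t:{0..pi}|lborel. poisson r t * g t))"
      by (simp add: set_integral_complex_of_real del: of_real_mult)
    finally show ?thesis
      unfolding F_def by (simp add: scaleR_conv_of_real)
  qed
qed

section \<open>Pointwise bounds for cosine and the Poisson kernel\<close>

lemma one_minus_cos_ge:
  fixes t :: real
  assumes "0 \<le> t" "t \<le> 1"
  shows "t\<^sup>2 / 4 \<le> 1 - cos t"
proof -
  \<comment> \<open>Since 1 < pi / 3, the cosine is at least 1/2 on [0, 1]; integrating twice from 0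
    gives first \<open>sin x \<ge> x / 2\<close> and then the claim.\<close>
  have cos_ge: "1 / 2 \<le> cos x" if "0 \<le> x" "x \<le> 1" for x :: real
    using cos_monotone_0_pi_le[of x "pi / 3"] that pi_gt3 by (simp add: cos_60)
  have sin_ge: "x / 2 \<le> sin x" if "0 \<le> x" "x \<le> 1" for x :: real
  proof -
    have "sin 0 - 0 / 2 \<le> sin x - x / 2"
    proof (rule DERIV_nonneg_imp_nondecreasing[OF that(1)])
      fix y assume y: "0 \<le> y" "y \<le> x"
      have "((\<lambda>x. sin x - x / 2) has_real_derivative cos y - 1 / 2) (at y)"
        by (auto intro!: derivative_eq_intros)
      then show "\<exists>d. ((\<lambda>x. sin x - x / 2) has_real_derivative d) (at y) \<and> 0 \<le> d"
        using cos_ge[of y] y that by auto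
    qed
    then show ?thesis by simp
  qed
  have "1 - cos 0 - 0\<^sup>2 / 4 \<le> 1 - cos t - t\<^sup>2 / 4"
  proof (rule DERIV_nonneg_imp_nondecreasing[OF assms(1)])
    fix y assume y: "0 \<le> y" "y \<le> t"
    have "((\<lambda>x. 1 - cos x - x\<^sup>2 / 4) has_real_derivative sin y - y / 2) (at y)"
      by (auto intro!: derivative_eq_intros)
    then show "\<exists>d. ((\<lambda>x. 1 - cos x - x\<^sup>2 / 4) has_real_derivative d) (at y) \<and> 0 \<le> d"
      using sin_ge[of y] y assms by auto
  qed
  then show ?thesis by simp
qed

lemma poisson_nonneg: "0 < r \<Longrightarrow> r < 1 \<Longrightarrow> 0 \<le> poisson r t"
  unfolding poisson_def by (intro divide_nonneg_nonneg add_nonneg_nonneg) (auto simp: power_le_one)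

text \<open>Dropping the cosine term of the denominator bounds the kernel by (1 + r) / (1 - r). This
  holds for every t, so it also gives integrability of the kernel times \<open>g\<close>.\<close>

lemma poisson_le_near:
  assumes "0 < r" "r < 1"
  shows "(1 - r) * poisson r t \<le> 2"
proof -
  have "(1 - r) * (1 - r\<^sup>2) \<le> 2 * ((1 - r)\<^sup>2 + 2 * r * (1 - cos t))"
  proof -
    have "(1 - r) * (1 - r\<^sup>2) = (1 + r) * (1 - r)\<^sup>2"
      by algebra
    also have "\<dots> \<le> 2 * (1 - r)\<^sup>2"
      using assms by (intro mult_right_mono) auto
    also have "\<dots> \<le> 2 * ((1 - r)\<^sup>2 + 2 * r * (1 - cos t))"
      using assms by simp
    finally show ?thesis .
  qed
  moreover have "0 < (1 - r)\<^sup>2 + 2 * r * (1 - cos t)"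
    using assms by (intro add_pos_nonneg) auto
  ultimately show ?thesis
    by (simp add: poisson_def pos_divide_le_eq)
qed

lemma poisson_ge_near:
  assumes "0 < r" "r < 1" "\<bar>t\<bar> \<le> 1 - r"
  shows "1 \<le> 2 * (1 - r) * poisson r t"
proof -
  \<comment> \<open>Half-angle formula: \<open>1 - cos t\<close> is twice the square of
    \<open>sin (t / 2)\<close>.\<close>
  have "1 - cos t \<le> t\<^sup>2 / 2"
    using cos_double_sin[of "t / 2"]
      abs_le_square_iff[of "sin (t / 2)" "t / 2"] abs_sin_x_le_abs_x[of "t / 2"]
    by (simp add: power_divide)
  moreover have "t\<^sup>2 \<le> (1 - r)\<^sup>2"
    using assms by (simp add: abs_le_square_iff[symmetric])
  ultimately have "2 * r * (1 - cos t) \<le> r * (1 - r)\<^sup>2"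
    using assms by (simp add: mult.assoc)
  then have "(1 - r)\<^sup>2 + 2 * r * (1 - cos t) \<le> (1 + r) * (1 - r)\<^sup>2"
    by (simp add: algebra_simps)
  also have "\<dots> = (1 - r) * (1 - r\<^sup>2)"
    by algebra
  also have "\<dots> \<le> 2 * (1 - r) * (1 - r\<^sup>2)"
    using assms by (intro mult_right_mono) (auto simp: power_le_one)
  finally show ?thesis
    using assms add_pos_nonneg[of "(1 - r)\<^sup>2" "2 * r * (1 - cos t)"]
    by (simp add: poisson_def pos_le_divide_eq)
qed

text \<open>The denominator is at least \<open>t^2 / 4\<close>: for r at most 1/2 because (1 - r)^2
  is at least 1/4, otherwise because 2 r exceeds 1 and \<open>one_minus_cos_ge\<close> applies. With
  the numerator at most 2 (1 - r) this gives the factor 8.\<close>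

lemma poisson_le_far:
  assumes "0 < r" "r < 1" "0 < t" "t \<le> 1"
  shows "poisson r t \<le> 8 * ((1 - r) / t\<^sup>2)"
proof -
  have "t\<^sup>2 / 4 \<le> (1 - r)\<^sup>2 + 2 * r * (1 - cos t)"
  proof (cases "r \<le> 1 / 2")
    case True
    then have "(1 / 2)\<^sup>2 \<le> (1 - r)\<^sup>2"
      using assms by (intro power_mono) auto
    moreover have "t\<^sup>2 \<le> 1"
      using assms by (simp add: power_le_one)
    moreover have "0 \<le> 2 * r * (1 - cos t)"
      using assms by simp
    ultimately show ?thesis
      by (simp add: power_divide)
  next
    case False
    then have "1 * (1 - cos t) \<le> 2 * r * (1 - cos t)"
      by (intro mult_right_mono) auto
    moreover have "t\<^sup>2 / 4 \<le> 1 * (1 - cos t)"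
      using one_minus_cos_ge[of t] assms by simp
    ultimately show ?thesis
      by (intro add_increasing) auto
  qed
  moreover have "1 - r\<^sup>2 \<le> 2 * (1 - r)"
    using zero_le_power2[of "1 - r"] by (simp add: power2_diff)
  ultimately have "poisson r t \<le> (2 * (1 - r)) / (t\<^sup>2 / 4)"
    unfolding poisson_def using assms by (intro frac_le) auto
  then show ?thesis by simp
qed

text \<open>Multiplying by 1 - r makes the kernel of order 1 on [0, 1 - r]. The lower estimate
  discards the rest of the range; in the upper one, 10 is 2 from \<open>poisson_le_near\<close> plus
  8 from \<open>poisson_le_far\<close>.\<close>

lemma
  assumes int: "integrable lborel g"
    and nonneg: "\<And>t. 0 \<le> g t"
    and supp: "\<And>t. t \<notin> {0<..1} \<Longrightarrow> g t = 0"
    and anti: "antimono_on {0<..1} g"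
    and r: "0 < r" "r < 1"
  shows poisson_integral_ge:
      "(LINT t:{0..1 - r}|lborel. g t) \<le> 2 * ((1 - r) * (LINT t:{0..pi}|lborel. poisson r t * g t))"
    and poisson_integral_le:
      "(1 - r) * (LINT t:{0..pi}|lborel. poisson r t * g t) \<le> 10 * (LINT t:{0..1 - r}|lborel. g t)"
proof -
  define a where "a = 1 - r"
  have a: "0 < a" "a < 1" using r by (auto simp: a_def)
  have cont: "poisson r \<in> borel_measurable borel"
    unfolding poisson_def by measurable
  have full: "(LINT t:{0..pi}|lborel. poisson r t * g t) = (\<integral>t. poisson r t * g t \<partial>lborel)"
    unfolding set_lebesgue_integral_def
  proof (rule Bochner_Integration.integral_cong[OF refl])
    show "indicator {0..pi} t *\<^sub>R (poisson r t * g t) = poisson r t * g t" for t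
      using supp[of t] pi_gt3 by (cases "t \<in> {0<..1}") auto
  qed
  have int_a: "integrable lborel (\<lambda>t. indicator {0..a} t * g t)"
    using int integrable_mult_indicator[of "{0..a}" lborel g] by simp
  have int_p: "integrable lborel (\<lambda>t. a * (poisson r t * g t))"
  proof (rule Bochner_Integration.integrable_bound)
    show "integrable lborel (\<lambda>t. 2 * g t)" using int by simp
    show "(\<lambda>t. a * (poisson r t * g t)) \<in> borel_measurable lborel"
      using cont int by measurable
    have "a * (poisson r t * g t) \<le> 2 * g t" for t
      using mult_right_mono[OF poisson_le_near[OF r, of t] nonneg[of t]] by (simp add: a_def mult.assoc)
    then show "AE t in lborel. norm (a * (poisson r t * g t)) \<le> norm (2 * g t)"
      using a nonneg poisson_nonneg[OF r] by (simp add: abs_mult)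
  qed
  have "(\<integral>t. indicator {0..a} t * g t \<partial>lborel) \<le> (\<integral>t. 2 * (a * (poisson r t * g t)) \<partial>lborel)"
  proof (rule integral_mono[OF int_a])
    show "integrable lborel (\<lambda>t. 2 * (a * (poisson r t * g t)))" using int_p by simp
    show "indicator {0..a} t * g t \<le> 2 * (a * (poisson r t * g t))" for t
    proof (cases "t \<in> {0..a}")
      case True
      then have "1 * g t \<le> (2 * a * poisson r t) * g t"
        using poisson_ge_near[OF r, of t] by (intro mult_right_mono nonneg) (auto simp: a_def)
      then show ?thesis using True by (simp add: mult.assoc)
    qed (use a nonneg poisson_nonneg[OF r] in simp)
  qed
  then show "(LINT t:{0..1 - r}|lborel. g t) \<le> 2 * ((1 - r) * (LINT t:{0..pi}|lborel. poisson r t * g t))"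
    unfolding full unfolding set_lebesgue_integral_def by (simp add: a_def)
  \<comment> \<open>The tail majorant without its constant. Its antiderivative
    \<open>- a / t\<close> gives total mass 1 - a, which stays below 1 however small a is.\<close>
  define k where "k t = a / t\<^sup>2 * indicator {a..1} t" for t
  have ftc: "has_bochner_integral lborel k ((- a / 1) - (- a / a))"
    unfolding k_def
  proof (rule has_bochner_integral_FTC_Icc_real)
    show "a \<le> 1" using a by simp
    show "((\<lambda>t. - a / t) has_real_derivative a / t\<^sup>2) (at t)" if "a \<le> t" "t \<le> 1" for t
      using that a by (auto intro!: derivative_eq_intros simp: power2_eq_square)
    show "isCont (\<lambda>t. a / t\<^sup>2) t" if "a \<le> t" "t \<le> 1" for t
      using that a by (intro continuous_intros) auto
  qed
  have ga: "a * g a \<le> (\<integral>t. indicator {0..a} t * g t \<partial>lborel)"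
  proof -
    \<comment> \<open>The point 0 is left out because \<open>g 0 = 0\<close>, so
      \<open>g a \<le> g t\<close> can fail there; the length is still a.\<close>
    have "a * g a = (\<integral>t. indicator {0<..a} t * g a \<partial>lborel)"
      using a by simp
    also have "\<dots> \<le> (\<integral>t. indicator {0..a} t * g t \<partial>lborel)"
    proof (rule integral_mono[OF _ int_a])
      show "integrable lborel (\<lambda>t. indicator {0<..a} t * g a)"
        using a by simp
      show "indicator {0<..a} t * g a \<le> indicator {0..a} t * g t" for t
        using monotone_onD[OF anti, of t a] a nonneg[of t] by (auto simp: indicator_def)
    qed
    finally show ?thesis .
  qed
  \<comment> \<open>One summand of the majorant handles t up to a, the other the tail, where also
    \<open>g t \<le> g a\<close>; each is nonnegative where the other does the work.\<close>
  have "(\<integral>t. a * (poisson r t * g t) \<partial>lborel)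
      \<le> (\<integral>t. 2 * (indicator {0..a} t * g t) + 8 * (a * g a) * k t \<partial>lborel)"
  proof (rule integral_mono[OF int_p])
    show "integrable lborel
        (\<lambda>t. 2 * (indicator {0..a} t * g t) + 8 * (a * g a) * k t)"
      using int_a ftc by (intro Bochner_Integration.integrable_add integrable_mult_right)
        (auto simp: has_bochner_integral_iff)
    show "a * (poisson r t * g t)
        \<le> 2 * (indicator {0..a} t * g t) + 8 * (a * g a) * k t" for t
    proof -
      consider "t \<notin> {0<..1}" | "0 < t" "t \<le> a" | "a < t" "t \<le> 1" by force
      then show ?thesis
      proof cases
        case 1
        then show ?thesis
          using supp[of t] a nonneg[of a] by (simp add: k_def)
      next
        case 2
        have "a * (poisson r t * g t) \<le> 2 * g t"
          using mult_right_mono[OF poisson_le_near[OF r, of t] nonneg[of t]]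
          by (simp add: a_def mult.assoc)
        moreover have "0 \<le> 8 * (a * g a) * k t"
          using a nonneg[of a] by (simp add: k_def)
        ultimately show ?thesis
          using 2 by simp
      next
        case 3
        have "poisson r t * g t \<le> (8 * (a / t\<^sup>2)) * g a"
          using 3 a poisson_le_far[OF r, of t] monotone_onD[OF anti, of a t] nonneg[of t]
          by (intro mult_mono) (auto simp: a_def)
        then have "a * (poisson r t * g t) \<le> a * ((8 * (a / t\<^sup>2)) * g a)"
          using a by (intro mult_left_mono) auto
        then show ?thesis
          using 3 by (simp add: k_def mult_ac)
      qed
    qed
  qed
  also have "\<dots> = 2 * (\<integral>t. indicator {0..a} t * g t \<partial>lborel) + 8 * (a * g a) * (1 - a)"
    using int_a ftc a
    by (subst Bochner_Integration.integral_add) (auto simp: has_bochner_integral_iff)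
  also have "8 * (a * g a) * (1 - a) \<le> 8 * (a * g a)"
    using a nonneg[of a] by (intro mult_left_le) auto
  finally show "(1 - r) * (LINT t:{0..pi}|lborel. poisson r t * g t) \<le> 10 * (LINT t:{0..1 - r}|lborel. g t)"
    unfolding full unfolding set_lebesgue_integral_def using ga by (simp add: a_def)
qed

section \<open>The weight\<close>

text \<open>The value \<open>h 0\<close> may be infinite, hence the truncation to \<open>{0<..1}\<close>.\<close>

definition real_weight :: "(real \<Rightarrow> ennreal) \<Rightarrow> real \<Rightarrow> real" where
  "real_weight h t = (if 0 < t \<and> t \<le> 1 then enn2real (h t) else 0)"

lemma real_weight_nonneg: "0 \<le> real_weight h t"
  by (simp add: real_weight_def)

lemma antimono_on_real_weight:
  assumes "admissible_weight h"
  shows "antimono_on {0<..1} (real_weight h)"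
proof (rule monotone_onI)
  fix s t :: real
  assume st: "s \<in> {0<..1}" "t \<in> {0<..1}" "s \<le> t"
  with assms have "h t \<le> h s" "h s < \<infinity>"
    unfolding admissible_weight_def by (auto dest: monotone_onD[of _ _ _ h s t])
  then show "real_weight h t \<le> real_weight h s"
    using st by (simp add: real_weight_def enn2real_mono)
qed

lemma borel_measurable_real_weight:
  assumes "admissible_weight h"
  shows "real_weight h \<in> borel_measurable borel"
proof -
  have "mono_on {0<..1} (\<lambda>t. - real_weight h t)"
    using antimono_on_real_weight[OF assms] by (auto simp: monotone_on_def)
  then have "(\<lambda>t. - (- real_weight h t)) \<in> borel_measurable (restrict_space borel {0<..1})"
    by (intro borel_measurable_uminus borel_measurable_mono_on_fnc)
  then have "(\<lambda>t. indicator {0<..1} t *\<^sub>R real_weight h t) \<in> borel_measurable borel"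
    by (subst (asm) borel_measurable_restrict_space_iff) auto
  also have "(\<lambda>t. indicator {0<..1} t *\<^sub>R real_weight h t) = real_weight h"
    by (auto simp: real_weight_def indicator_def)
  finally show ?thesis .
qed

lemma nn_integral_real_weight:
  assumes "admissible_weight h" "x \<le> 1"
  shows "(\<integral>\<^sup>+t. ennreal (indicator {0..x} t * real_weight h t) \<partial>lborel) = (\<integral>\<^sup>+t\<in>{0..x}. h t \<partial>lborel)"
proof (rule nn_integral_cong_AE)
  show "AE t in lborel. ennreal (indicator {0..x} t * real_weight h t) = h t * indicator {0..x} t"
    \<comment> \<open>At 0 the two sides may differ, by an infinite amount if \<open>h 0\<close> is
      infinite; elsewhere in [0, x] the value of \<open>h\<close> is finite and survives the
      conversion to reals.\<close>
    using AE_lborel_singleton[of 0]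
  proof eventually_elim
    case (elim t)
    have "h t < \<infinity>" if "0 < t" "t \<le> 1"
      using assms that by (auto simp: admissible_weight_def)
    then show ?case
      using elim assms(2) by (auto simp: real_weight_def indicator_def)
  qed
qed

lemma integrable_real_weight:
  assumes "admissible_weight h"
  shows "integrable lborel (real_weight h)"
proof -
  have eq: "indicator {0..1} t * real_weight h t = real_weight h t" for t
    by (auto simp: real_weight_def indicator_def)
  have "(\<integral>\<^sup>+t. ennreal (real_weight h t) \<partial>lborel) < \<infinity>"
    using nn_integral_real_weight[OF assms, of 1] assms unfolding eq
    by (simp add: admissible_weight_def)
  then show ?thesis
    using borel_measurable_real_weight[OF assms]
    by (intro integrableI_nonneg) (auto simp: real_weight_nonneg)
qed

lemma weight_integral_eq:
  assumes "admissible_weight h" "x \<le> 1"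
  shows "weight_integral h x = (LINT t:{0..x}|lborel. real_weight h t)"
  unfolding weight_integral_def nn_integral_real_weight[OF assms, symmetric] set_lebesgue_integral_def
  using borel_measurable_real_weight[OF assms(1)]
  by (subst integral_eq_nn_integral) (auto simp: real_weight_nonneg)

section \<open>Construction of the outer function and comparison with the weight integral\<close>

theorem theorem6p10:
  fixes lam :: "nat \<Rightarrow> real" and h :: "real \<Rightarrow> ennreal" and w :: "nat \<Rightarrow> complex"
  assumes "\<And>n. lam n \<in> {0<..<1}"
    and "interpolating (\<lambda>n. complex_of_real (lam n))"
    and "admissible_weight h"
    and "\<And>n. w n \<noteq> 0"
    and "bounded (range w)"
    and "comparable (\<lambda>n. - (1 - lam n) * ln (cmod (w n))) (\<lambda>n. weight_integral h (1 - lam n))"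
  shows "\<exists>\<psi>. bounded_outer_function \<psi> \<and>
    (\<forall>n. Im (\<psi> (complex_of_real (lam n))) = 0 \<and> 0 < Re (\<psi> (complex_of_real (lam n)))) \<and>
    comparable (\<lambda>n. - (1 - lam n) * ln (Re (\<psi> (complex_of_real (lam n)))))
      (\<lambda>n. weight_integral h (1 - lam n))"
proof -
  define g where "g = real_weight h"
  have g_int: "integrable lborel g" and g_meas: "g \<in> borel_measurable borel"
    and anti: "antimono_on {0<..1} g" and g_nonneg: "\<And>t. 0 \<le> g t"
    and supp: "\<And>t. t \<notin> {0<..1} \<Longrightarrow> g t = 0"
    using assms(3) integrable_real_weight borel_measurable_real_weight antimono_on_real_weight
    by (auto simp: g_def real_weight_def)
  have g_set: "set_integrable lborel {0..pi} g"
    unfolding set_integrable_def using g_int by (intro integrable_mult_indicator) auto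
  \<comment> \<open>\<open>arccos (Re \<xi>)\<close> is the unsigned angle of \<xi>, so
    \<open>v\<close> is symmetric under conjugation, and it is finite even at \<xi> = 1 because
    \<open>g 0 = 0\<close>.\<close>
  define v where "v \<xi> = - g (arccos (Re \<xi>))" for \<xi> :: complex
  define \<psi> where "\<psi> z = exp (\<integral>\<xi>. herglotz \<xi> z * complex_of_real (v \<xi>) \<partial>circle_measure)" for z
  define P where "P r = (LINT t:{0..pi}|lborel. poisson r t * g t)" for r
  have v_int: "integrable circle_measure v"
    unfolding v_def by (intro Bochner_Integration.integrable_minus integrable_arccos_Re g_meas g_set)
  have bdd: "bounded_outer_function \<psi>"
    unfolding \<psi>_def
    by (rule bounded_outer_function_exp_herglotz[OF v_int]) (simp add: v_def g_nonneg)
  \<comment> \<open>The symmetric weight makes the exponent real on (0, 1), which gives positivity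
    and identifies \<open>- ln\<close> of the value as \<open>P r / pi\<close>.\<close>
  have \<psi>_eq: "\<psi> (of_real r) = of_real (exp (- (1 / pi * P r)))" if "0 < r" "r < 1" for r
    using herglotz_integral_arccos_Re[OF g_meas g_set, of r] that
    unfolding \<psi>_def v_def P_def by (simp flip: exp_of_real)
  have ln_\<psi>: "- (1 - lam n) * ln (Re (\<psi> (complex_of_real (lam n)))) = (1 - lam n) * P (lam n) / pi" for n
    using \<psi>_eq[of "lam n"] assms(1)[of n] by (simp add: left_diff_distrib diff_divide_distrib)
  have H: "weight_integral h (1 - lam n) = (LINT t:{0..1 - lam n}|lborel. g t)" for n
    unfolding g_def using assms(1)[of n] by (intro weight_integral_eq assms(3)) auto
  have "comparable (\<lambda>n. - (1 - lam n) * ln (Re (\<psi> (complex_of_real (lam n)))))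
      (\<lambda>n. weight_integral h (1 - lam n))"
    unfolding comparable_def ln_\<psi> H
  \<comment> \<open>The constants 10 and 2 of the Poisson estimates, each combined with the factor
    pi that undoes the normalization 1 / pi.\<close>
  proof (rule exI[of _ "pi / 10"], intro conjI, simp, rule exI[of _ "2 * pi"], intro conjI allI)
    fix n
    have r: "0 < lam n" "lam n < 1" using assms(1)[of n] by auto
    show "pi / 10 * ((1 - lam n) * P (lam n) / pi) \<le> (LINT t:{0..1 - lam n}|lborel. g t)"
      using poisson_integral_le[OF g_int g_nonneg supp anti r] by (simp add: P_def)
    show "(LINT t:{0..1 - lam n}|lborel. g t) \<le> 2 * pi * ((1 - lam n) * P (lam n) / pi)"
      using poisson_integral_ge[OF g_int g_nonneg supp anti r] by (simp add: P_def)
  qed auto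
  moreover have "Im (\<psi> (complex_of_real (lam n))) = 0 \<and> 0 < Re (\<psi> (complex_of_real (lam n)))" for n
    using \<psi>_eq[of "lam n"] assms(1)[of n] by simp
  ultimately show ?thesis
    using bdd by blast
qed

end
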